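(* Let $H<G$ be infinite finitely generated groups admitting compactifications $\overline H=\Gamma(H,B)\cup\partial H$ and $\overline G=\Gamma(G,A)\cup\partial G$. Suppose there exists $h\in H$ such that: (1) $h$ acts with North-South dynamics on $\partial H$; (2) $h$ fixes pointwise a subset $L\subset\partial G$ such that $|L|\ge 3$ and $L\subseteq\Lambda_G(H)$, where $\Lambda_G(H)$ denotes the limit set of $H$ in $\partial G$. Then the inclusion $i:H\hookrightarrow G$ does not extend to an $H$-equivariant continuous map $\partial i:\partial H\to\partial G$ (i.e. there is no Cannon--Thurston map for the pair $(H,G)$).
   Context: COMPACTIFICATIONS. For a finitely generated group $G$ with Cayley graph $\Gamma(G,A)$ ($A$ a finite generating set), a compactification is a compact space $\overline G=\Gamma(G,A)\cup\partial G$ such that the inclusion $\Gamma(G,A)\to\overline G$ is a topological embedding with dense open image. It is assumed that $\overline G$ is metrizable and independent of the choice of Cayley graph, and that each $g\in G$ induces a homeomorphism $\partial G\to\partial G$ (the one obtained by continuously extending left multiplication by $g$ to $\overline G$). Every boundary point is understood to be a limit of a sequence of group elements. LIMIT SET. For $H<G$, $\Lambda_G(H)$ is the set of $p\in\partial G$ for which there is a sequence $\{h_n\}$ in $H$ converging to $p$ in $\overline G$. CANNON--THURSTON MAP (extension of the inclusion). A Cannon--Thurston map for $(H,G)$ is a continuous map $f:\partial H\to\partial G$ such that for every $\xi\in\partial H$ and every sequence $\{h_i\}$ in $H$ with $h_i\to\xi$ in $\overline H$, one has $h_i\to f(\xi)$ in $\overline G$. Such a map is $H$-equivariant. NORTH-SOUTH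 DYNAMICS. A homeomorphism $g$ of a topological space $Z$ acts with North-South dynamics if $g$ fixes two points $z^+\ne z^-$ of $Z$ and for any open sets $U,V$ with $z^-\in U$, $z^+\in V$ there is an integer $N$ such that $g^n(Z\setminus U)\subset V$ and $g^{-n}(Z\setminus V)\subset U$ for all $n\ge N$. *)

theory Defs
  imports "HOL-Analysis.Analysis" "HOL-Algebra.Generated_Groups"
begin

definition finite_generating_set :: "('a, 'm) monoid_scheme \<Rightarrow> 'a set \<Rightarrow> bool" where
  "finite_generating_set G A \<longleftrightarrow> finite A \<and> A \<subseteq> carrier G \<and> generate G A = carrier G"


section \<open>Cayley graphs as topological spaces\<close>

text \<open>
  The Cayley graph, with an edge joining \<open>g\<close> to \<open>g a\<close> for every generator \<open>a\<close>, is given by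
  its geometric realization in barycentric coordinates: a point is a function on the group, a
  vertex \<open>g\<close> being the indicator of \<open>g\<close>. Loops and repeated edges are thereby ignored.
  The space \<open>cayley_graph G A\<close> carries the topology of pointwise convergence, i.e. the subspace
  topology from the function type; for finite \<open>A\<close> the graph is locally finite, and this is its
  usual (CW, equivalently path-metric) topology.
\<close>

definition vertex :: "'a \<Rightarrow> 'a \<Rightarrow> real" where
  "vertex g = (\<lambda>x. if x = g then 1 else 0)"

definition edge_point :: "'a \<Rightarrow> 'a \<Rightarrow> real \<Rightarrow> 'a \<Rightarrow> real" where
  "edge_point g k t = (\<lambda>x. (1 - t) * vertex g x + t * vertex k x)"

definition cayley_graph :: "('a, 'm) monoid_scheme \<Rightarrow> 'a set \<Rightarrow> ('a \<Rightarrow> real) set" where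
  "cayley_graph G A = vertex ` carrier G \<union>
     {edge_point g (g \<otimes>\<^bsub>G\<^esub> a) t | g a t. g \<in> carrier G \<and> a \<in> A \<and> 0 \<le> t \<and> t \<le> 1}"

text \<open>Left translation by \<open>g\<close>, sending the vertex \<open>k\<close> to \<open>g k\<close> and affine on edges.\<close>

definition left_mult :: "('a, 'm) monoid_scheme \<Rightarrow> 'a \<Rightarrow> ('a \<Rightarrow> real) \<Rightarrow> 'a \<Rightarrow> real" where
  "left_mult G g u = (\<lambda>x. if x \<in> carrier G then u (inv\<^bsub>G\<^esub> g \<otimes>\<^bsub>G\<^esub> x) else 0)"


section \<open>Compactifications\<close>

text \<open>
  A compactification is a topology on the disjoint union of the Cayley graph (left summand) and
  a boundary set (right summand).
\<close>

type_synonym ('a, 'b) cpt_point = "('a \<Rightarrow> real) + 'b"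

definition boundary :: "('a, 'b) cpt_point topology \<Rightarrow> ('a, 'b) cpt_point set" where
  "boundary X = topspace X \<inter> range Inr"

abbreviation boundary_top :: "('a, 'b) cpt_point topology \<Rightarrow> ('a, 'b) cpt_point topology" where
  "boundary_top X \<equiv> subtopology X (boundary X)"

definition elt :: "'a \<Rightarrow> ('a, 'b) cpt_point" where
  "elt g = Inl (vertex g)"

definition cayley_compactification ::
    "('a, 'm) monoid_scheme \<Rightarrow> 'a set \<Rightarrow> ('a, 'b) cpt_point topology \<Rightarrow> bool" where
  "cayley_compactification G A X \<longleftrightarrow>
     compact_space X \<and>
     topspace X = Inl ` cayley_graph G A \<union> boundary X \<and>
     embedding_map (top_of_set (cayley_graph G A)) X Inl \<and>
     openin X (Inl ` cayley_graph G A) \<and>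
     X closure_of (Inl ` cayley_graph G A) = topspace X"

definition extends_left_mult ::
    "('a, 'm) monoid_scheme \<Rightarrow> 'a set \<Rightarrow> ('a, 'b) cpt_point topology \<Rightarrow> 'a \<Rightarrow>
     (('a, 'b) cpt_point \<Rightarrow> ('a, 'b) cpt_point) \<Rightarrow> bool" where
  "extends_left_mult G A X g F \<longleftrightarrow>
     continuous_map X X F \<and> (\<forall>u \<in> cayley_graph G A. F (Inl u) = Inl (left_mult G g u))"

text \<open>
  The homeomorphism of the boundary induced by \<open>g\<close>. Since the Cayley graph is dense, the
  extension is unique on \<open>topspace X\<close> when \<open>X\<close> is Hausdorff, so that the description below is
  meaningful at boundary points of an \<open>equivariant_compactification\<close>.
\<close>

definition boundary_action ::
    "('a, 'm) monoid_scheme \<Rightarrow> 'a set \<Rightarrow> ('a, 'b) cpt_point topology \<Rightarrow> 'a \<Rightarrow>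
     ('a, 'b) cpt_point \<Rightarrow> ('a, 'b) cpt_point" where
  "boundary_action G A X g p = (THE q. \<exists>F. extends_left_mult G A X g F \<and> q = F p)"

definition equivariant_compactification ::
    "('a, 'm) monoid_scheme \<Rightarrow> 'a set \<Rightarrow> ('a, 'b) cpt_point topology \<Rightarrow> bool" where
  "equivariant_compactification G A X \<longleftrightarrow>
     cayley_compactification G A X \<and>
     metrizable_space X \<and>
     (\<forall>g \<in> carrier G. \<exists>F. extends_left_mult G A X g F \<and>
        homeomorphic_map (boundary_top X) (boundary_top X) F) \<and>
     (\<forall>p \<in> boundary X. \<exists>k::nat \<Rightarrow> 'a. range k \<subseteq> carrier G \<and>
        limitin X (\<lambda>n. elt (k n)) p sequentially)"

text \<open>
  Independence of the Cayley graph: for every other finite generating set there is a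
  compactification of the corresponding Cayley graph with the same boundary that induces the
  same topology on the union of the group and the boundary.
\<close>

definition admissible_compactification ::
    "('a, 'm) monoid_scheme \<Rightarrow> 'a set \<Rightarrow> ('a, 'b) cpt_point topology \<Rightarrow> bool" where
  "admissible_compactification G A X \<longleftrightarrow>
     equivariant_compactification G A X \<and>
     (\<forall>A'. finite_generating_set G A' \<longrightarrow>
        (\<exists>X'. equivariant_compactification G A' X' \<and> boundary X' = boundary X \<and>
           subtopology X' (elt ` carrier G \<union> boundary X) =
           subtopology X (elt ` carrier G \<union> boundary X)))"


section \<open>Limit sets, Cannon--Thurston maps, North-South dynamics\<close>

definition limit_set :: "('a, 'b) cpt_point topology \<Rightarrow> 'a set \<Rightarrow> ('a, 'b) cpt_point set" where
  "limit_set X H = {p \<in> boundary X. \<exists>k::nat \<Rightarrow> 'a. range k \<subseteq> H \<and>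
     limitin X (\<lambda>n. elt (k n)) p sequentially}"

text \<open>Here \<open>Y\<close> compactifies the subgroup \<open>H\<close> and \<open>X\<close> the ambient group.\<close>

definition cannon_thurston_map ::
    "'a set \<Rightarrow> ('a, 'c) cpt_point topology \<Rightarrow> ('a, 'b) cpt_point topology \<Rightarrow>
     (('a, 'c) cpt_point \<Rightarrow> ('a, 'b) cpt_point) \<Rightarrow> bool" where
  "cannon_thurston_map H Y X f \<longleftrightarrow>
     continuous_map (boundary_top Y) (boundary_top X) f \<and>
     (\<forall>\<xi> \<in> boundary Y. \<forall>k::nat \<Rightarrow> 'a. range k \<subseteq> H \<longrightarrow>
        limitin Y (\<lambda>n. elt (k n)) \<xi> sequentially \<longrightarrow>
        limitin X (\<lambda>n. elt (k n)) (f \<xi>) sequentially)"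

definition north_south_dynamics :: "'z topology \<Rightarrow> ('z \<Rightarrow> 'z) \<Rightarrow> bool" where
  "north_south_dynamics Z g \<longleftrightarrow>
     homeomorphic_map Z Z g \<and>
     (\<exists>zp \<in> topspace Z. \<exists>zm \<in> topspace Z. zp \<noteq> zm \<and> g zp = zp \<and> g zm = zm \<and>
        (\<forall>U V. openin Z U \<and> openin Z V \<and> zm \<in> U \<and> zp \<in> V \<longrightarrow>
           (\<exists>N::nat. \<forall>n\<ge>N. (g ^^ n) ` (topspace Z - U) \<subseteq> V \<and>
              (inv_into (topspace Z) g ^^ n) ` (topspace Z - V) \<subseteq> U)))"


section \<open>Basic facts\<close>

lemma left_mult_vertex:
  assumes "group G" "g \<in> carrier G" "k \<in> carrier G"
  shows "left_mult G g (vertex k) = vertex (g \<otimes>\<^bsub>G\<^esub> k)"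
proof -
  interpret group G by fact
  show ?thesis
    using assms by (auto simp: left_mult_def vertex_def fun_eq_iff m_assoc[symmetric])
qed

lemma boundary_action_eq:
  assumes X: "cayley_compactification G A X" "metrizable_space X"
    and F: "extends_left_mult G A X g F" and p: "p \<in> topspace X"
  shows "boundary_action G A X g p = F p"
proof -
  have unique: "F' p = F p" if F': "extends_left_mult G A X g F'" for F'
  proof (rule forall_in_closure_of_eq[of p X "Inl ` cayley_graph G A" X F' F])
    show "p \<in> X closure_of (Inl ` cayley_graph G A)"
      using X p by (simp add: cayley_compactification_def)
    show "Hausdorff_space X"
      using X by (simp add: metrizable_imp_Hausdorff_space)
    show "continuous_map X X F'" "continuous_map X X F"
      using F F' by (auto simp: extends_left_mult_def)
    show "F' x = F x" if "x \<in> Inl ` cayley_graph G A" for x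
      using F F' that by (auto simp: extends_left_mult_def)
  qed
  show ?thesis
    unfolding boundary_action_def by (rule the_equality) (use F unique in blast)+
qed

lemma limitin_translate:
  assumes "group G" "g \<in> carrier G" "range k \<subseteq> carrier G"
    and F: "extends_left_mult G A X g F"
    and lim: "limitin X (\<lambda>n. elt (k n)) p sequentially"
  shows "limitin X (\<lambda>n. elt (g \<otimes>\<^bsub>G\<^esub> k n)) (F p) sequentially"
proof -
  have "limitin X (F \<circ> (\<lambda>n. elt (k n))) (F p) sequentially"
    using F lim by (auto simp: extends_left_mult_def intro: continuous_map_limit)
  moreover have "F (elt (k n)) = elt (g \<otimes>\<^bsub>G\<^esub> k n)" for n
  proof -
    have "k n \<in> carrier G" using assms(3) by auto
    then show ?thesis
      using F assms(1,2) by (simp add: elt_def extends_left_mult_def cayley_graph_def left_mult_vertex)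
  qed
  ultimately show ?thesis by (simp add: comp_def)
qed

text \<open>Equivariance is not part of the definition of a Cannon--Thurston map: it is automatic.\<close>

lemma cannon_thurston_map_equivariant:
  assumes G: "group G" and H: "subgroup H G"
    and Y: "equivariant_compactification (G\<lparr>carrier := H\<rparr>) B Y"
    and X: "equivariant_compactification G A X"
    and f: "cannon_thurston_map H Y X f"
    and h: "h \<in> H" and xi: "\<xi> \<in> boundary Y"
  shows "f (boundary_action (G\<lparr>carrier := H\<rparr>) B Y h \<xi>) = boundary_action G A X h (f \<xi>)"
proof -
  let ?H = "G\<lparr>carrier := H\<rparr>"
  have gH: "group ?H" using G H by (simp add: subgroup.subgroup_is_group)
  have HG: "H \<subseteq> carrier G" using H by (rule subgroup.subset)
  obtain E where E: "extends_left_mult ?H B Y h E"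
      and Eh: "homeomorphic_map (boundary_top Y) (boundary_top Y) E"
    using Y h unfolding equivariant_compactification_def by auto
  obtain F where F: "extends_left_mult G A X h F"
    using X h HG unfolding equivariant_compactification_def by blast
  obtain k :: "nat \<Rightarrow> _" where k: "range k \<subseteq> H" "limitin Y (\<lambda>n. elt (k n)) \<xi> sequentially"
    using Y xi unfolding equivariant_compactification_def by auto
  have Exi: "E \<xi> \<in> boundary Y"
    using homeomorphic_imp_surjective_map[OF Eh] xi
    by (auto simp: boundary_def)
  have "limitin Y (\<lambda>n. elt (h \<otimes>\<^bsub>G\<^esub> k n)) (E \<xi>) sequentially"
    using limitin_translate[OF gH _ _ E k(2)] h k(1) by simp
  moreover have "range (\<lambda>n. h \<otimes>\<^bsub>G\<^esub> k n) \<subseteq> H"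
    using h k(1) H by (auto intro!: subgroup.m_closed)
  ultimately have 1: "limitin X (\<lambda>n. elt (h \<otimes>\<^bsub>G\<^esub> k n)) (f (E \<xi>)) sequentially"
    using f Exi unfolding cannon_thurston_map_def by blast
  have fk: "limitin X (\<lambda>n. elt (k n)) (f \<xi>) sequentially"
    using f xi k unfolding cannon_thurston_map_def by blast
  have 2: "limitin X (\<lambda>n. elt (h \<otimes>\<^bsub>G\<^esub> k n)) (F (f \<xi>)) sequentially"
    using limitin_translate[OF G _ _ F fk] h k(1) HG by auto
  have haus: "Hausdorff_space X"
    using X by (simp add: equivariant_compactification_def metrizable_imp_Hausdorff_space)
  have "f (E \<xi>) = F (f \<xi>)"
    using limitin_Hausdorff_unique[OF 1 2 _ haus] by simp
  moreover have "boundary_action ?H B Y h \<xi> = E \<xi>"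
    using Y E xi by (intro boundary_action_eq) (auto simp: equivariant_compactification_def boundary_def)
  moreover have "boundary_action G A X h (f \<xi>) = F (f \<xi>)"
    using X F limitin_topspace[OF fk]
    by (intro boundary_action_eq) (auto simp: equivariant_compactification_def)
  ultimately show ?thesis by simp
qed

end

theory Submission
  imports Defs
begin

text \<open>
  A Cannon--Thurston map \<open>f\<close> has the whole limit set of \<open>H\<close> in its image: if elements \<open>h\<^sub>n\<close> of \<open>H\<close>
  converge to a boundary point \<open>p\<close> of \<open>G\<close>, then by sequential compactness a subsequence converges
  in the compactification of \<open>H\<close>, and its limit \<open>\<xi>\<close> lies on the boundary, since otherwise the
  subsequence would be eventually constant and \<open>p\<close> would be a group element. By the defining
  property of \<open>f\<close> this forces \<open>f \<xi> = p\<close> (\<open>limit_set_subset_image\<close>).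

  Now let \<open>p = f \<xi>\<close> be fixed by \<open>h\<close>. Equivariance makes \<open>f\<close> constant, with value \<open>p\<close>, on the
  forward orbit of \<open>\<xi>\<close> under \<open>h\<close>. If \<open>\<xi>\<close> is not the repelling point \<open>z\<^sup>-\<close>, this orbit accumulates
  at the attracting point \<open>z\<^sup>+\<close>, and continuity gives \<open>p = f z\<^sup>+\<close>; otherwise \<open>p = f z\<^sup>-\<close>. Hence \<open>f\<close>
  can hit at most two fixed points of \<open>h\<close> (\<open>north_south_fixed_image\<close>), while \<open>L\<close> consists of at
  least three.
\<close>

text \<open>
  A sequence of vertices takes only the values 0 and 1 at each group element, and a point of the
  realized graph is nonzero at some \<open>g\<close>. Convergence in the \<open>g\<close>-coordinate therefore
  pins the sequence to \<open>g\<close>: the group is discrete inside its Cayley graph.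
\<close>

lemma vertex_limit_eventually_const:
  assumes X: "cayley_compactification G A X"
    and k: "range k \<subseteq> carrier G"
    and u: "u \<in> cayley_graph G A"
    and lim: "limitin X (\<lambda>n. elt (k n)) (Inl u) sequentially"
  shows "\<exists>g. eventually (\<lambda>n. k n = g) sequentially"
proof -
  let ?C = "cayley_graph G A"
  have kC: "vertex (k n) \<in> ?C" for n
    using k by (auto simp: cayley_graph_def)
  have "homeomorphic_map (top_of_set ?C) (subtopology X (Inl ` ?C)) Inl"
    using X by (simp add: cayley_compactification_def embedding_map_def)
  then obtain r where r: "homeomorphic_maps (top_of_set ?C) (subtopology X (Inl ` ?C)) Inl r"
    by (auto simp: homeomorphic_map_maps)
  have rInl: "r (Inl v) = v" if "v \<in> ?C" for v
    using r that by (auto simp: homeomorphic_maps_def)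
  have "limitin (subtopology X (Inl ` ?C)) (\<lambda>n. elt (k n)) (Inl u) sequentially"
    using lim u kC by (auto simp: limitin_subtopology elt_def)
  then have "limitin (top_of_set ?C) (r \<circ> (\<lambda>n. elt (k n))) (r (Inl u)) sequentially"
    using r by (auto simp: homeomorphic_maps_def intro: continuous_map_limit)
  then have "limitin (top_of_set ?C) (\<lambda>n. vertex (k n)) u sequentially"
    by (simp add: comp_def elt_def rInl kC u)
  then have lim_u: "((\<lambda>n. vertex (k n)) \<longlongrightarrow> u) sequentially"
    by (simp add: limitin_subtopology)
  have "\<exists>g. u g \<noteq> 0"
  proof -
    have edge: "\<exists>x. edge_point g k t x \<noteq> 0" for g k :: 'a and t :: real
    proof (cases "t = 0 \<or> g = k")
      case True
      then have "edge_point g k t g = 1" by (auto simp: edge_point_def vertex_def)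
      then show ?thesis by (metis zero_neq_one)
    next
      case False
      then have "edge_point g k t k = t" by (auto simp: edge_point_def vertex_def)
      then show ?thesis using False by metis
    qed
    have "\<exists>x. vertex g x \<noteq> 0" for g :: 'a
      by (rule exI[of _ g]) (simp add: vertex_def)
    then show ?thesis using u edge by (auto simp: cayley_graph_def)
  qed
  then obtain g where g: "u g \<noteq> 0" by blast
  have "((\<lambda>n. vertex (k n) g) \<longlongrightarrow> u g) sequentially"
    using continuous_on_tendsto_compose[OF continuous_on_product_coordinates lim_u, of g] by simp
  then have "eventually (\<lambda>n. vertex (k n) g \<noteq> 0) sequentially"
    using g by (rule tendsto_imp_eventually_ne)
  then have "eventually (\<lambda>n. k n = g) sequentially"
    by (rule eventually_mono) (auto simp: vertex_def split: if_splits)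
  then show ?thesis ..
qed

text \<open>
  Metrizability turns compactness into a choice of convergent subsequences. Such a limit must be
  kept out of the Cayley graph, where the Cannon--Thurston property says nothing.
\<close>

lemma limit_set_subset_image:
  assumes Y: "cayley_compactification (G\<lparr>carrier := H\<rparr>) B Y" "metrizable_space Y"
    and X: "Hausdorff_space X"
    and f: "cannon_thurston_map H Y X f"
  shows "limit_set X H \<subseteq> f ` boundary Y"
proof
  fix p assume "p \<in> limit_set X H"
  then obtain k :: "nat \<Rightarrow> 'a" where p: "p \<in> boundary X" and k: "range k \<subseteq> H"
    and kp: "limitin X (\<lambda>n. elt (k n)) p sequentially"
    by (auto simp: limit_set_def)
  have topY: "topspace Y = Inl ` cayley_graph (G\<lparr>carrier := H\<rparr>) B \<union> boundary Y"
    using Y by (simp add: cayley_compactification_def)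
  have "range (\<lambda>n. elt (k n)) \<subseteq> topspace Y"
    using k unfolding topY by (auto simp: elt_def cayley_graph_def)
  then obtain \<xi> r where r: "strict_mono (r :: nat \<Rightarrow> nat)"
    and xi: "limitin Y ((\<lambda>n. elt (k n)) \<circ> r) \<xi> sequentially"
  proof -
    obtain M d where d: "Metric_space M d" and Yd: "Y = Metric_space.mtopology M d"
      using Y by (auto simp: metrizable_space_def)
    have "compact_space (Metric_space.mtopology M d)"
      using Y Yd by (simp add: cayley_compactification_def)
    moreover have "range (\<lambda>n. elt (k n)) \<subseteq> M"
      using \<open>range _ \<subseteq> topspace Y\<close> d by (simp add: Yd Metric_space.topspace_mtopology)
    ultimately show thesis
      using that d unfolding Yd Metric_space.compact_space_sequentially[OF d] by blast
  qed
  have xi: "limitin Y (\<lambda>n. elt (k (r n))) \<xi> sequentially"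
    using xi by (simp add: comp_def)
  have krp: "limitin X (\<lambda>n. elt (k (r n))) p sequentially"
    using limitin_subsequence[OF r kp] by (simp add: comp_def)
  have kr: "range (\<lambda>n. k (r n)) \<subseteq> H" using k by auto
  have "\<xi> \<in> boundary Y"
  proof (rule ccontr)
    assume "\<xi> \<notin> boundary Y"
    then obtain u where u: "u \<in> cayley_graph (G\<lparr>carrier := H\<rparr>) B" "\<xi> = Inl u"
      using limitin_topspace[OF xi] topY by auto
    then obtain g where g: "eventually (\<lambda>n. k (r n) = g) sequentially"
      using vertex_limit_eventually_const[OF Y(1) _ u(1)] xi kr by fastforce
    then have "limitin X (\<lambda>n. elt g) p sequentially"
      by (intro limitin_transform_eventually[OF _ krp]) (auto elim: eventually_mono)
    then have "p = elt g"
      using Abstract_Topological_Spaces.limitin_const_iff[OF Hausdorff_imp_t1_space[OF X]]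
      by (metis sequentially_bot)
    then show False
      using p by (auto simp: boundary_def elt_def)
  qed
  moreover from this have "limitin X (\<lambda>n. elt (k (r n))) (f \<xi>) sequentially"
    using f kr xi unfolding cannon_thurston_map_def by blast
  then have "f \<xi> = p"
    using limitin_Hausdorff_unique krp X by (metis sequentially_bot)
  ultimately show "p \<in> f ` boundary Y" by blast
qed

text \<open>
  The two exceptional values are the images of the poles. A fixed value is attained along a whole
  forward orbit; unless the orbit starts at the repelling pole, it enters every neighbourhood of
  the attracting pole, so continuity admits no value but the one there.
\<close>

lemma north_south_fixed_image:
  assumes T: "north_south_dynamics Z T"
    and Z: "t1_space Z" and W: "t1_space W"
    and f: "continuous_map Z W f"
    and eq: "\<And>x. x \<in> topspace Z \<Longrightarrow> f (T x) = F (f x)"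
  shows "\<exists>a b. \<forall>x \<in> topspace Z. F (f x) = f x \<longrightarrow> f x \<in> {a, b}"
proof -
  obtain zp zm where zp: "zp \<in> topspace Z" and zm: "zm \<in> topspace Z"
    and ns: "\<And>U V. \<lbrakk>openin Z U; openin Z V; zm \<in> U; zp \<in> V\<rbrakk> \<Longrightarrow>
      \<exists>N::nat. \<forall>n\<ge>N. (T ^^ n) ` (topspace Z - U) \<subseteq> V"
    using T unfolding north_south_dynamics_def by metis
  have TZ: "T x \<in> topspace Z" if "x \<in> topspace Z" for x
    using T that unfolding north_south_dynamics_def
    by (metis homeomorphic_imp_surjective_map imageI)
  have "f x = f zp" if x: "x \<in> topspace Z" and fixed: "F (f x) = f x" and ne: "x \<noteq> zm" for x
  proof (rule ccontr)
    assume ne': "f x \<noteq> f zp"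
    have orbit: "(T ^^ n) x \<in> topspace Z \<and> f ((T ^^ n) x) = f x" for n
      by (induction n) (use x fixed eq TZ in auto)
    let ?V = "{z \<in> topspace Z. f z \<in> topspace W - {f x}}"
    have fx: "f x \<in> topspace W" and "f zp \<in> topspace W"
      using f x zp by (auto simp: continuous_map_def)
    then have "zp \<in> ?V" using zp ne' by auto
    moreover have "openin Z ?V"
      using f W fx by (intro openin_continuous_map_preimage[of Z W])
        (auto intro: openin_diff closedin_t1_singleton)
    moreover have "openin Z (topspace Z - {x})"
      using Z x by (auto intro: openin_diff closedin_t1_singleton)
    \<comment> \<open>The complement of \<open>{x}\<close>, as neighbourhood of the repelling pole, singles out the orbit of \<open>x\<close>.\<close>
    ultimately obtain N where "\<forall>n\<ge>N. (T ^^ n) ` (topspace Z - (topspace Z - {x})) \<subseteq> ?V"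
      using ns[of "topspace Z - {x}" ?V] zm ne by auto
    then have "(T ^^ N) x \<in> ?V" using x by blast
    then show False using orbit[of N] by auto
  qed
  then show ?thesis by blast
qed

theorem lemma2p23:
  fixes G :: "('a, 'm) monoid_scheme"
    and H A B :: "'a set" and L :: "('a, 'b) cpt_point set" and h :: 'a
    and X :: "('a, 'b) cpt_point topology"
    and Y :: "('a, 'c) cpt_point topology"
  assumes "group G" and "subgroup H G"
    and "infinite (carrier G)" and "infinite H"
    and "finite_generating_set G A"
    and "finite_generating_set (G\<lparr>carrier := H\<rparr>) B"
    and "admissible_compactification G A X"
    and "admissible_compactification (G\<lparr>carrier := H\<rparr>) B Y"
    and "h \<in> H"
    and "north_south_dynamics (boundary_top Y) (boundary_action (G\<lparr>carrier := H\<rparr>) B Y h)"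
    and "L \<subseteq> boundary X" and "infinite L \<or> 3 \<le> card L"
    and "L \<subseteq> limit_set X H"
    and "\<forall>p \<in> L. boundary_action G A X h p = p"
  shows "\<not> (\<exists>f. cannon_thurston_map H Y X f)"
proof
  assume "\<exists>f. cannon_thurston_map H Y X f"
  then obtain f where f: "cannon_thurston_map H Y X f" ..
  let ?H = "G\<lparr>carrier := H\<rparr>"
  have X: "equivariant_compactification G A X" and Y: "equivariant_compactification ?H B Y"
    using assms(7,8) by (auto simp: admissible_compactification_def)
  have haus: "Hausdorff_space X" "Hausdorff_space Y"
    using X Y by (auto simp: equivariant_compactification_def metrizable_imp_Hausdorff_space)
  have top: "topspace (boundary_top Y) = boundary Y"
    by (auto simp: boundary_def)
  have "\<exists>a b. \<forall>x \<in> topspace (boundary_top Y).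
      boundary_action G A X h (f x) = f x \<longrightarrow> f x \<in> {a, b}"
  proof (rule north_south_fixed_image[OF assms(10)])
    show "t1_space (boundary_top Y)" "t1_space (boundary_top X)"
      using haus by (auto intro: Hausdorff_imp_t1_space Hausdorff_space_subtopology)
    show "continuous_map (boundary_top Y) (boundary_top X) f"
      using f by (simp add: cannon_thurston_map_def)
    show "f (boundary_action ?H B Y h x) = boundary_action G A X h (f x)"
      if "x \<in> topspace (boundary_top Y)" for x
      using that cannon_thurston_map_equivariant[OF assms(1,2) Y X f assms(9)] by (simp only: top)
  qed
  then obtain a b where ab: "\<And>x. \<lbrakk>x \<in> boundary Y; boundary_action G A X h (f x) = f x\<rbrakk> \<Longrightarrow>
      f x \<in> {a, b}"
    unfolding top by blast
  have "L \<subseteq> f ` boundary Y"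
    using limit_set_subset_image[OF _ _ haus(1) f, of G B] Y assms(13)
    by (auto simp: equivariant_compactification_def)
  then have L: "L \<subseteq> {a, b}"
    using ab assms(14) by fastforce
  have "finite L" using L by (rule finite_subset) simp
  moreover have "card L \<le> card {a, b}" using L by (intro card_mono) auto
  moreover have "card {a, b} \<le> 2" by (simp add: card_insert_if)
  ultimately show False using assms(12) by linarith
qed

end
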